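(* Let $A\in\mathbb{C}^{n\times n}$ satisfy $A=V\Lambda V^{-1}$ with $\Lambda=\operatorname{diag}(\lambda_1,\ldots,\lambda_n)$ and $V\in\mathbb{C}^{n\times n}$ invertible. Let $E\in\mathbb{C}^{n\times n}$ and $\tilde{A}=A+E$. Then every eigenvalue $\tilde{\lambda}$ of $\tilde{A}$ satisfies $$\min_{1\le k\le n}|\tilde{\lambda}-\lambda_k|\le\kappa(V)\,\|E\|_2,\qquad \kappa(V)=\|V\|_2\,\|V^{-1}\|_2.$$
   Context: For a matrix, $\|\cdot\|_2$ denotes the spectral norm (operator norm induced by the Euclidean norm). *)

theory Defs
  imports "HOL-Analysis.Analysis"
begin

text \<open>
  The norm that \<open>onorm\<close> uses on \<open>complex ^ 'n\<close> is the Euclidean one, and the supremum ranges over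
  all complex vectors.
\<close>
definition spectral_norm :: "complex ^ 'n ^ 'm \<Rightarrow> real" where
  "spectral_norm M = onorm ((*v) M)"

definition condition_number :: "complex ^ 'n ^ 'n \<Rightarrow> real" where
  "condition_number V = spectral_norm V * spectral_norm (matrix_inv V)"

definition diag_matrix :: "('n \<Rightarrow> complex) \<Rightarrow> complex ^ 'n ^ 'n" where
  "diag_matrix d = (\<chi> i j. if i = j then d i else 0)"

definition is_eigenvalue :: "complex ^ 'n ^ 'n \<Rightarrow> complex \<Rightarrow> bool" where
  "is_eigenvalue M \<mu> \<longleftrightarrow> (\<exists>x. x \<noteq> 0 \<and> M *v x = \<mu> *s x)"

end

theory Submission
  imports Defs
begin

text \<open>
  This is the Bauer--Fike theorem. In the coordinates \<open>y = V\<^sup>-\<^sup>1 x\<close> of an eigenvector \<open>x\<close> of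
  \<open>V \<Lambda> V\<^sup>-\<^sup>1 + E\<close>, the eigenvalue equation reads \<open>(\<mu> - \<Lambda>) y = V\<^sup>-\<^sup>1 E V y\<close>. The left-hand side
  multiplies each coordinate of \<open>y\<close> by a number of modulus at least \<open>min |\<mu> - \<lambda>\<^sub>k|\<close>, so it is at
  least that many times as long as \<open>y\<close> (\<open>norm_ge_of_stretched_components\<close>). The right-hand side is
  at most \<open>\<parallel>V\<^sup>-\<^sup>1\<parallel> \<parallel>E\<parallel> \<parallel>V\<parallel>\<close> times as long (\<open>norm_mult_vec_le_spectral_norm\<close>). As \<open>y \<noteq> 0\<close>, its
  length cancels. Comparing lengths of vectors in this way, rather than inverting \<open>\<mu> - \<Lambda>\<close>, treats
  the case where \<open>\<mu>\<close> is itself one of the \<open>\<lambda>\<^sub>k\<close> on the same footing as the others.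
\<close>

lemma norm_mult_vec_le_spectral_norm:
  fixes M :: "complex ^ 'n ^ 'm"
  shows "norm (M *v x) \<le> spectral_norm M * norm x"
  unfolding spectral_norm_def by (rule onorm [OF matrix_vector_mul_bounded_linear])

lemma spectral_norm_nonneg: "0 \<le> spectral_norm M"
  unfolding spectral_norm_def by (rule onorm_pos_le [OF matrix_vector_mul_bounded_linear])

lemma matrix_inv_cancel:
  fixes V :: "'a::semiring_1 ^ 'n ^ 'm"
  assumes "invertible V"
  shows "V ** matrix_inv V = mat 1" and "matrix_inv V ** V = mat 1"
  using someI_ex [OF assms [unfolded invertible_def]] by (simp_all add: matrix_inv_def)

lemma diag_matrix_mult_vec_component: "(diag_matrix d *v x) $ i = d i * x $ i"
  by (simp add: diag_matrix_def matrix_vector_mult_def if_distrib[of "\<lambda>z. z * _"] cong: if_cong)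

lemma norm_ge_of_stretched_components:
  fixes y z :: "complex ^ 'n"
  assumes "0 \<le> m" and "\<And>i. m * norm (y $ i) \<le> norm (z $ i)"
  shows "m * norm y \<le> norm z"
proof -
  have "norm (m *\<^sub>R y) \<le> norm z"
    by (rule norm_le_componentwise_cart) (use assms in simp)
  then show ?thesis
    using assms(1) by simp
qed

text \<open>
  Since \<open>x = V y\<close>, the eigenvalue equation is \<open>V D y + E V y = \<mu> V y\<close>. Applying \<open>V\<^sup>-\<^sup>1\<close>
  separates the contribution of \<open>D\<close> from that of the perturbation.
\<close>
lemma perturbed_eigenvector_in_eigenbasis:
  fixes V E D :: "complex ^ 'n ^ 'n"
  assumes V: "invertible V" and x: "(V ** D ** matrix_inv V + E) *v x = \<mu> *s x"
  defines "y \<equiv> matrix_inv V *v x"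
  shows "\<mu> *s y - D *v y = matrix_inv V *v (E *v (V *v y))"
proof -
  have WV: "matrix_inv V ** V = mat 1" and VW: "V ** matrix_inv V = mat 1"
    using V by (simp_all add: matrix_inv_cancel)
  have Vy: "V *v y = x"
    unfolding y_def by (simp add: matrix_vector_mul_assoc VW)
  have "\<mu> *s y = matrix_inv V *v (\<mu> *s x)"
    by (simp add: y_def vector_scalar_commute)
  also have "\<dots> = matrix_inv V *v (V *v (D *v y)) + matrix_inv V *v (E *v x)"
    by (simp add: y_def x [symmetric] matrix_vector_mult_add_rdistrib matrix_vector_right_distrib
        matrix_vector_mul_assoc matrix_mul_assoc)
  also have "matrix_inv V *v (V *v (D *v y)) = D *v y"
    by (simp add: matrix_vector_mul_assoc matrix_mul_assoc WV)
  finally show ?thesis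
    by (simp add: Vy)
qed

theorem theorem4p1:
  fixes A V E A' :: "complex ^ 'n ^ 'n"
    and l :: "'n \<Rightarrow> complex"
    and \<mu> :: complex
  assumes "invertible V"
    and "A = V ** diag_matrix l ** matrix_inv V"
    and "A' = A + E"
    and "is_eigenvalue A' \<mu>"
  shows "Min ((\<lambda>k. cmod (\<mu> - l k)) ` UNIV) \<le> condition_number V * spectral_norm E"
proof -
  define m where "m = Min ((\<lambda>k. cmod (\<mu> - l k)) ` UNIV)"
  have m_le: "m \<le> cmod (\<mu> - l k)" for k
    unfolding m_def by (rule Min_le) auto
  have m_nonneg: "0 \<le> m"
    unfolding m_def by (subst Min_ge_iff) auto
  obtain x where "x \<noteq> 0" and x: "A' *v x = \<mu> *s x"
    using assms(4) by (auto simp: is_eigenvalue_def)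
  define W where "W = matrix_inv V"
  define y where "y = W *v x"
  have "V *v y = x"
    using assms(1) by (simp add: y_def W_def matrix_vector_mul_assoc matrix_inv_cancel)
  with \<open>x \<noteq> 0\<close> have "y \<noteq> 0"
    by auto
  have "m * norm y \<le> norm (\<mu> *s y - diag_matrix l *v y)"
  proof (rule norm_ge_of_stretched_components [OF m_nonneg])
    fix i
    have "(\<mu> *s y - diag_matrix l *v y) $ i = (\<mu> - l i) * y $ i"
      by (simp add: diag_matrix_mult_vec_component algebra_simps)
    then show "m * norm (y $ i) \<le> norm ((\<mu> *s y - diag_matrix l *v y) $ i)"
      using m_le [of i] by (simp add: norm_mult mult_right_mono)
  qed
  also have "\<dots> = norm (W *v (E *v (V *v y)))"
    using perturbed_eigenvector_in_eigenbasis [OF assms(1)] x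
    by (simp add: assms(2,3) W_def y_def)
  also have "\<dots> \<le> spectral_norm W * (spectral_norm E * (spectral_norm V * norm y))"
    by (intro order_trans [OF norm_mult_vec_le_spectral_norm] mult_left_mono
        norm_mult_vec_le_spectral_norm spectral_norm_nonneg)
  also have "\<dots> = (condition_number V * spectral_norm E) * norm y"
    by (simp add: condition_number_def W_def)
  finally show ?thesis
    using \<open>y \<noteq> 0\<close> by (simp add: m_def)
qed

end
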